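(* Let $R>0$, let $J\in C(\mathbb{R})$ satisfy $J\ge 0$, $\int_{\mathbb{R}}J=1$, and suppose there exist $\alpha<0<\beta$ with $J(\alpha)>0$ and $J(\beta)>0$. Let $\mathcal{M}[u]=J\star u-u$. Suppose $a:\mathbb{R}\to\mathbb{R}$ is Lipschitz and $2R$-periodic. Then the operator $-(\mathcal{M}+a(x))$ has a unique principal eigenvalue $\lambda_1$ in $C_{per}(\mathbb{R})$; that is, there is a unique $\lambda_1\in\mathbb{R}$ such that $$\mathcal{M}[\phi_1]+a(x)\phi_1=-\lambda_1\phi_1\quad\text{in }\mathbb{R}$$ admits a positive solution $\phi_1\in C_{per}(\mathbb{R})$. Moreover, $\lambda_1$ is simple, that is, the space of solutions in $C_{per}(\mathbb{R})$ of this equation (with this $\lambda_1$) is one dimensional.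
   Context: $C_{per}(\mathbb{R})$ is the space of continuous $2R$-periodic functions $u:\mathbb{R}\to\mathbb{R}$. Convolution: $(J\star u)(x)=\int_{\mathbb{R}}J(x-y)u(y)\,dy$. *)

theory Defs
  imports "HOL-Analysis.Analysis" "HOL-Library.Function_Algebras" "HOL-Library.Periodic_Fun"
begin

definition C_per :: "real \<Rightarrow> (real \<Rightarrow> real) set" where
  "C_per R = {u. continuous_on UNIV u \<and> periodic_fun_simple u (2 * R)}"

(* The Bochner integral is 0 by convention when the integrand is not integrable; this never
   happens below, where J is integrable and u is continuous and periodic, hence bounded. *)
definition convol :: "(real \<Rightarrow> real) \<Rightarrow> (real \<Rightarrow> real) \<Rightarrow> real \<Rightarrow> real" where
  "convol J u x = (\<integral>y. J (x - y) * u y \<partial>lborel)"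

definition M_op :: "(real \<Rightarrow> real) \<Rightarrow> (real \<Rightarrow> real) \<Rightarrow> real \<Rightarrow> real" where
  "M_op J u x = convol J u x - u x"

definition eigen_solutions ::
  "real \<Rightarrow> (real \<Rightarrow> real) \<Rightarrow> (real \<Rightarrow> real) \<Rightarrow> real \<Rightarrow> (real \<Rightarrow> real) set" where
  "eigen_solutions R J a l =
     {\<phi> \<in> C_per R. \<forall>x. M_op J \<phi> x + a x * \<phi> x = - l * \<phi> x}"

definition principal_eigenvalue ::
  "real \<Rightarrow> (real \<Rightarrow> real) \<Rightarrow> (real \<Rightarrow> real) \<Rightarrow> real \<Rightarrow> bool" where
  "principal_eigenvalue R J a l \<longleftrightarrow> (\<exists>\<phi> \<in> eigen_solutions R J a l. \<forall>x. \<phi> x > 0)"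

(* The function type is not an instance of real_vector, so the notions of subspace and dimension
   are taken from the vector_space locale, with the pointwise operations on functions. *)
definition fun_scale :: "real \<Rightarrow> (real \<Rightarrow> real) \<Rightarrow> real \<Rightarrow> real" where
  "fun_scale c f = (\<lambda>x. c * f x)"

interpretation fun_vs: vector_space fun_scale
  by unfold_locales (auto simp: fun_scale_def fun_eq_iff algebra_simps)

(* dim is 0 for infinite-dimensional spaces, so dim = 1 does mean one-dimensional;
   as dim S is the dimension of the span of S, the subspace property is stated too. *)
definition simple_eigenvalue ::
  "real \<Rightarrow> (real \<Rightarrow> real) \<Rightarrow> (real \<Rightarrow> real) \<Rightarrow> real \<Rightarrow> bool" where
  "simple_eigenvalue R J a l \<longleftrightarrow>
     fun_vs.subspace (eigen_solutions R J a l) \<and> fun_vs.dim (eigen_solutions R J a l) = 1"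

end

theory Submission
  imports Defs "HOL-Complex_Analysis.Great_Picard"
begin

text \<open>
  With \<open>\<mu> = 1 - \<lambda>\<close> the equation reads \<open>J \<star> \<phi> = (\<mu> - a) \<phi>\<close>. Let \<open>m\<close> be the infimum of the
  \<open>\<mu> > max a\<close> that admit a positive strict supersolution, \<open>J \<star> v < (\<mu> - a) v\<close>.

  Integrals over short intervals and iteration around the circle give a Harnack inequality
  \<open>v \<ge> \<epsilon> \<integral> v\<close> for supersolutions, the integral being over a short interval around the maximum
  point of \<open>a\<close>. Then \<open>v \<ge> \<epsilon> (\<integral> v) / (\<mu> - a)\<close>, and integrating once more bounds
  \<open>\<integral> 1 / (\<mu> - a)\<close>. As \<open>a\<close> is Lipschitz, this integral diverges logarithmically when \<open>\<mu>\<close>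
  tends to \<open>max a\<close>; hence \<open>m > max a\<close>.

  For \<open>\<mu>\<close> above \<open>m\<close>, monotone iteration solves \<open>(\<mu> - a) u = 1 + J \<star> u\<close>. By minimality of \<open>m\<close>
  the solutions blow up as \<open>\<mu>\<close> tends to \<open>m\<close>, and since \<open>u \<mapsto> J \<star> u\<close> is compact (continuity of
  translations in \<open>L\<^sup>1\<close> and Arzela-Ascoli) their normalisations converge to an eigenfunction, which
  is positive by the Harnack inequality. Uniqueness and simplicity follow by comparing an
  eigenfunction with the smallest multiple of a positive one lying above it: where the two touch,
  the nonlocal term of the difference is nonnegative.
\<close>

subsection \<open>Continuous periodic functions\<close>

lemma C_per_continuous: "u \<in> C_per R \<Longrightarrow> continuous_on UNIV u"
  by (simp add: C_per_def)

lemma C_per_measurable: "u \<in> C_per R \<Longrightarrow> u \<in> borel_measurable borel"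
  by (simp add: C_per_def borel_measurable_continuous_onI)

lemma C_per_plus_of_int:
  assumes "u \<in> C_per R"
  shows "u (x + of_int k * (2 * R)) = u x"
proof -
  interpret periodic_fun_simple u "2 * R" using assms by (simp add: C_per_def)
  show ?thesis by (rule plus_of_int)
qed

lemma C_perI:
  assumes "continuous_on UNIV u" "\<And>x. u (x + 2 * R) = u x"
  shows "u \<in> C_per R"
  using assms by (auto simp: C_per_def periodic_fun_simple_def)

lemma C_perD: "u \<in> C_per R \<Longrightarrow> u (x + 2 * R) = u x"
  by (simp add: C_per_def periodic_fun_simple_def)

lemma C_per_arith:
  assumes "u \<in> C_per R" "v \<in> C_per R"
  shows "(\<lambda>x. u x + v x) \<in> C_per R" "(\<lambda>x. u x - v x) \<in> C_per R"
    "(\<lambda>x. u x * v x) \<in> C_per R"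
  using assms by (auto intro!: C_perI continuous_intros dest: C_per_continuous simp: C_perD)

lemma C_per_const: "(\<lambda>x. c) \<in> C_per R"
  by (auto intro!: C_perI)

lemma C_per_divide:
  assumes "u \<in> C_per R" "v \<in> C_per R" "\<And>x. v x \<noteq> 0"
  shows "(\<lambda>x. u x / v x) \<in> C_per R"
  using assms by (auto intro!: C_perI continuous_intros dest: C_per_continuous simp: C_perD)

text \<open>The one-sided bound serves the reduction to \<open>{0..2 * R}\<close>; the bound on the
  distance serves the Harnack inequality, where a point has to be brought near a prescribed
  target.\<close>

lemma period_translate:
  fixes R x y :: real
  assumes "R > 0"
  obtains k :: int where "\<bar>x + of_int k * (2 * R) - y\<bar> \<le> 2 * R"
    "y \<le> x + of_int k * (2 * R)"
proof
  let ?k = "- \<lfloor>(x - y) / (2 * R)\<rfloor>"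
  have "of_int \<lfloor>(x - y) / (2 * R)\<rfloor> \<le> (x - y) / (2 * R)" by simp
  hence a: "of_int \<lfloor>(x - y) / (2 * R)\<rfloor> * (2 * R) \<le> x - y"
    using assms by (subst (asm) pos_le_divide_eq) auto
  have "(x - y) / (2 * R) < of_int \<lfloor>(x - y) / (2 * R)\<rfloor> + 1" by linarith
  hence b: "x - y < (of_int \<lfloor>(x - y) / (2 * R)\<rfloor> + 1) * (2 * R)"
    using assms by (subst (asm) pos_divide_less_eq) auto
  show "\<bar>x + of_int ?k * (2 * R) - y\<bar> \<le> 2 * R" "y \<le> x + of_int ?k * (2 * R)"
    using a b by (simp_all add: algebra_simps)
qed

text \<open>The point \<open>y\<close> does not depend on \<open>u\<close>, so one representative
  serves a whole sequence of periodic functions at once.\<close>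

lemma C_per_reduce:
  assumes "R > 0"
  obtains y where "y \<in> {0..2 * R}" "\<And>u. u \<in> C_per R \<Longrightarrow> u x = u y"
proof -
  obtain k :: int where k: "\<bar>x + of_int k * (2 * R) - 0\<bar> \<le> 2 * R" "0 \<le> x + of_int k * (2 * R)"
    using period_translate[OF assms, of x 0] by metis
  show ?thesis
    using k by (intro that[of "x + of_int k * (2 * R)"]) (auto simp: C_per_plus_of_int)
qed

lemma C_per_attains_sup:
  assumes "u \<in> C_per R" "R > 0"
  obtains x where "\<And>y. u y \<le> u x"
proof -
  have "continuous_on {0..2*R} u" using assms(1) by (auto dest: C_per_continuous intro: continuous_on_subset)
  then obtain x where x: "x \<in> {0..2*R}" "\<And>y. y \<in> {0..2*R} \<Longrightarrow> u y \<le> u x"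
    using continuous_attains_sup[of "{0..2*R}" u] assms(2) by auto
  show ?thesis
  proof (rule that[of x])
    fix y show "u y \<le> u x"
      using C_per_reduce[OF assms(2), of y] assms(1) x by metis
  qed
qed

lemma C_per_attains_inf:
  assumes "u \<in> C_per R" "R > 0"
  obtains x where "\<And>y. u x \<le> u y"
proof -
  obtain x where "\<And>y. 0 - u y \<le> 0 - u x"
    using C_per_attains_sup[OF C_per_arith(2)[OF C_per_const assms(1)] assms(2)] by blast
  thus ?thesis by (intro that[of x]) simp
qed

lemma C_per_bounded:
  assumes "u \<in> C_per R" "R > 0"
  obtains B where "\<And>x. \<bar>u x\<bar> \<le> B"
proof -
  obtain p where p: "\<And>y. u y \<le> u p" using C_per_attains_sup[OF assms] by blast
  obtain q where q: "\<And>y. u q \<le> u y" using C_per_attains_inf[OF assms] by blast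
  show ?thesis
  proof (rule that[of "\<bar>u p\<bar> + \<bar>u q\<bar>"])
    fix x show "\<bar>u x\<bar> \<le> \<bar>u p\<bar> + \<bar>u q\<bar>" using p[of x] q[of x] by linarith
  qed
qed

subsection \<open>Convolution with a probability density\<close>

locale dispersal_kernel =
  fixes J :: "real \<Rightarrow> real"
  assumes cont_J: "continuous_on UNIV J"
    and J_nonneg: "\<And>x. J x \<ge> 0"
    and J_integrable: "integrable lborel J"
    and J_integral: "(\<integral>x. J x \<partial>lborel) = 1"
begin

lemma J_measurable [measurable]: "J \<in> borel_measurable borel"
  by (rule borel_measurable_continuous_onI[OF cont_J])

lemma J_shift_integrable: "integrable lborel (\<lambda>y. J (x - y))"
  using lborel_integrable_real_affine[OF J_integrable, of "-1" x] by simp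

lemma J_shift_integral: "(\<integral>y. J (x - y) \<partial>lborel) = 1"
  using lborel_integral_real_affine[of "-1" J x] J_integral by simp

lemma convol_integrable:
  assumes [measurable]: "u \<in> borel_measurable borel" and B: "\<And>x. \<bar>u x\<bar> \<le> B"
  shows "integrable lborel (\<lambda>y. J (x - y) * u y)"
proof (rule Bochner_Integration.integrable_bound)
  show "integrable lborel (\<lambda>y. B * J (x - y))" using J_shift_integrable by simp
  show "AE y in lborel. norm (J (x - y) * u y) \<le> norm (B * J (x - y))"
  proof (rule AE_I2)
    fix y
    have "B \<ge> 0" using B[of 0] by linarith
    thus "norm (J (x - y) * u y) \<le> norm (B * J (x - y))"
      using mult_right_mono[OF B[of y] J_nonneg[of "x - y"]] J_nonneg[of "x - y"]
      by (simp add: abs_mult mult.commute)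
  qed
qed measurable

lemma C_per_convol_integrable:
  assumes "u \<in> C_per R" "R > 0"
  shows "integrable lborel (\<lambda>y. J (x - y) * u y)"
  using C_per_bounded[OF assms] convol_integrable[OF C_per_measurable[OF assms(1)]] by metis

lemma convol_const: "convol J (\<lambda>_. c) x = c"
  unfolding convol_def by (simp add: J_shift_integral)

lemma convol_mono:
  assumes "integrable lborel (\<lambda>y. J (x - y) * u y)" "integrable lborel (\<lambda>y. J (x - y) * v y)"
    and "\<And>y. u y \<le> v y"
  shows "convol J u x \<le> convol J v x"
  unfolding convol_def using assms J_nonneg by (intro integral_mono) (auto intro: mult_left_mono)

lemma convol_le:
  assumes "integrable lborel (\<lambda>y. J (x - y) * u y)" "\<And>y. u y \<le> B"
  shows "convol J u x \<le> B"
  using convol_mono[OF assms(1) _ assms(2)] J_shift_integrable convol_const by simp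

lemma convol_ge:
  assumes "integrable lborel (\<lambda>y. J (x - y) * u y)" "\<And>y. B \<le> u y"
  shows "B \<le> convol J u x"
  using convol_mono[OF _ assms] J_shift_integrable convol_const by simp

lemma convol_lincomb:
  assumes "u \<in> C_per R" "v \<in> C_per R" "R > 0"
  shows "convol J (\<lambda>x. c * u x - v x) x = c * convol J u x - convol J v x"
  using C_per_convol_integrable[OF assms(1,3), of x] C_per_convol_integrable[OF assms(2,3), of x]
  unfolding convol_def by (simp add: right_diff_distrib mult.left_commute)

lemma convol_cmult: "convol J (\<lambda>x. c * u x) x = c * convol J u x"
  unfolding convol_def by (simp add: mult.left_commute)


section \<open>Compactness of the convolution operator\<close>

lemma L1_translation_seq:
  assumes "X \<longlonglongrightarrow> x"
  shows "(\<lambda>n. \<integral>y. \<bar>J (X n - y) - J (x - y)\<bar> \<partial>lborel) \<longlonglongrightarrow> 0"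
proof -
  have nn: "(\<integral>\<^sup>+ y. norm (J (z - y)) \<partial>lborel) = 1" for z
    using nn_integral_eq_integral[OF J_shift_integrable] J_nonneg J_shift_integral by simp
  have "(\<lambda>n. \<integral>\<^sup>+ y. norm (J (X n - y) - J (x - y)) \<partial>lborel) \<longlonglongrightarrow> 0"
  \<comment> \<open>Continuity of \<open>J\<close> gives pointwise convergence of the translates,
    and all translates have the same norm 1; Scheffe's lemma upgrades this to convergence in
    L1.\<close>
  proof (rule Scheffe_lemma2)
    show "AE y in lborel. (\<lambda>n. J (X n - y)) \<longlonglongrightarrow> J (x - y)"
    proof (rule AE_I2)
      fix y show "(\<lambda>n. J (X n - y)) \<longlonglongrightarrow> J (x - y)"
        using assms cont_J by (intro continuous_on_tendsto_compose[OF cont_J]) (auto intro!: tendsto_intros)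
    qed
  qed (use nn in \<open>auto simp: J_shift_integrable simp del: real_norm_def\<close>)
  moreover have "(\<integral>\<^sup>+ y. norm (J (z - y) - J (x - y)) \<partial>lborel)
      = ennreal (\<integral>y. \<bar>J (z - y) - J (x - y)\<bar> \<partial>lborel)" for z
    using nn_integral_eq_integral[of lborel "\<lambda>y. \<bar>J (z - y) - J (x - y)\<bar>"] J_shift_integrable by simp
  ultimately have "(\<lambda>n. ennreal (\<integral>y. \<bar>J (X n - y) - J (x - y)\<bar> \<partial>lborel)) \<longlonglongrightarrow> ennreal 0"
    by simp
  thus ?thesis by (subst (asm) tendsto_ennreal_iff) auto
qed

text \<open>The difference of the two values is at most \<open>B\<close> times the L1 distance of
  two translates of \<open>J\<close>. Hence \<open>d\<close> depends on \<open>u\<close> only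
  through the bound \<open>B\<close>, which is the equicontinuity that Arzela-Ascoli asks
  for.\<close>

lemma convol_equicontinuous:
  assumes "e > 0" "B \<ge> 0"
  obtains d where "d > 0"
    "\<And>u z. u \<in> borel_measurable borel \<Longrightarrow> (\<And>y. \<bar>u y\<bar> \<le> B) \<Longrightarrow> \<bar>z - x\<bar> < d
      \<Longrightarrow> \<bar>convol J u z - convol J u x\<bar> < e"
proof -
  let ?w = "\<lambda>z. \<integral>y. \<bar>J (z - y) - J (x - y)\<bar> \<partial>lborel"
  have "continuous (at x) ?w"
    unfolding continuous_at_sequentially using L1_translation_seq by (auto simp: o_def)
  \<comment> \<open>\<open>B + 1\<close> replaces \<open>B\<close> because \<open>B\<close> may be
    0. Note that \<open>?w x = 0\<close>.\<close>
  moreover have "e / (B + 1) > 0" using assms by simp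
  ultimately obtain d where d: "d > 0" "\<And>z. dist z x < d \<Longrightarrow> dist (?w z) (?w x) < e / (B + 1)"
    unfolding continuous_at_eps_delta by blast
  show ?thesis
  proof (rule that[OF d(1)])
    fix u :: "real \<Rightarrow> real" and z
    assume u: "u \<in> borel_measurable borel" "\<And>y. \<bar>u y\<bar> \<le> B" and z: "\<bar>z - x\<bar> < d"
    have [measurable]: "u \<in> borel_measurable borel" by fact
    note i = convol_integrable[OF u]
    have ij: "integrable lborel (\<lambda>y. \<bar>J (z - y) - J (x - y)\<bar>)"
      using J_shift_integrable by simp
    have "convol J u z - convol J u x = (\<integral>y. J (z - y) * u y - J (x - y) * u y \<partial>lborel)"
      unfolding convol_def using i by simp
    hence "\<bar>convol J u z - convol J u x\<bar> = norm (\<integral>y. J (z - y) * u y - J (x - y) * u y \<partial>lborel)"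
      by simp
    also have "\<dots> \<le> (\<integral>y. norm (J (z - y) * u y - J (x - y) * u y) \<partial>lborel)"
      by (rule integral_norm_bound)
    also have "\<dots> \<le> (\<integral>y. B * \<bar>J (z - y) - J (x - y)\<bar> \<partial>lborel)"
    proof (rule integral_mono)
      show "integrable lborel (\<lambda>y. norm (J (z - y) * u y - J (x - y) * u y))" using i by simp
      show "integrable lborel (\<lambda>y. B * \<bar>J (z - y) - J (x - y)\<bar>)" using ij by simp
      fix y
      have "norm (J (z - y) * u y - J (x - y) * u y) = \<bar>u y\<bar> * \<bar>J (z - y) - J (x - y)\<bar>"
        by (metis abs_mult left_diff_distrib mult.commute real_norm_def)
      also have "\<dots> \<le> B * \<bar>J (z - y) - J (x - y)\<bar>" using u(2)[of y] by (intro mult_right_mono) auto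
      finally show "norm (J (z - y) * u y - J (x - y) * u y) \<le> B * \<bar>J (z - y) - J (x - y)\<bar>" .
    qed
    also have "\<dots> = B * ?w z" by simp
    also have "\<dots> \<le> (B + 1) * ?w z" by (intro mult_right_mono) auto
    also have "\<dots> < e" using d(2)[of z] z assms by (simp add: dist_real_def field_simps)
    finally show "\<bar>convol J u z - convol J u x\<bar> < e" .
  qed
qed

text \<open>Convolution smooths: measurability and a bound suffice for continuity. This is applied
  to pointwise limits whose own continuity is still unknown.\<close>

lemma convol_in_C_per:
  assumes u: "u \<in> borel_measurable borel" "\<And>y. \<bar>u y\<bar> \<le> B" and per: "\<And>x. u (x + 2 * R) = u x"
  shows "convol J u \<in> C_per R"
proof (rule C_perI)
  have B: "B \<ge> 0" using u(2)[of 0] by linarith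
  show "continuous_on UNIV (convol J u)"
    unfolding continuous_on_iff
  proof (intro ballI allI impI)
    fix x e :: real assume "e > 0"
    then obtain d where "d > 0" "\<And>z. \<bar>z - x\<bar> < d \<Longrightarrow> \<bar>convol J u z - convol J u x\<bar> < e"
      using convol_equicontinuous[OF _ B, of e x] u by metis
    thus "\<exists>d>0. \<forall>z\<in>UNIV. dist z x < d \<longrightarrow> dist (convol J u z) (convol J u x) < e"
      by (auto simp: dist_real_def)
  qed
  fix x
  have "convol J u (x + 2 * R) = (\<integral>y. J (x + 2 * R - (2 * R + 1 * y)) * u (2 * R + 1 * y) \<partial>lborel)"
    unfolding convol_def by (subst lborel_integral_real_affine[of 1 _ "2 * R"]) auto
  also have "\<dots> = convol J u x" unfolding convol_def by (simp add: add.commute[of "2 * R"] per)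
  finally show "convol J u (x + 2 * R) = convol J u x" .
qed

lemma C_per_convol:
  assumes "u \<in> C_per R" "R > 0"
  shows "convol J u \<in> C_per R"
  using C_per_bounded[OF assms] convol_in_C_per[OF C_per_measurable[OF assms(1)] _ C_perD[OF assms(1)]]
  by metis

lemma convol_tendsto:
  assumes U: "\<And>n. U n \<in> borel_measurable borel" "\<And>n y. \<bar>U n y\<bar> \<le> B"
    and lim: "\<And>y. (\<lambda>n. U n y) \<longlonglongrightarrow> u y"
  shows "(\<lambda>n. convol J (U n) x) \<longlonglongrightarrow> convol J u x"
  unfolding convol_def
proof (rule integral_dominated_convergence)
  have [measurable]: "\<And>n. U n \<in> borel_measurable borel" by fact
  have [measurable]: "u \<in> borel_measurable borel" by (rule borel_measurable_LIMSEQ_real[OF lim]) fact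
  show "(\<lambda>y. J (x - y) * u y) \<in> borel_measurable lborel" by measurable
  show "(\<lambda>y. J (x - y) * U n y) \<in> borel_measurable lborel" for n by measurable
  show "integrable lborel (\<lambda>y. J (x - y) * B)" using J_shift_integrable by simp
  show "AE y in lborel. (\<lambda>n. J (x - y) * U n y) \<longlonglongrightarrow> J (x - y) * u y"
    by (intro AE_I2 tendsto_mult lim tendsto_const)
  show "AE y in lborel. norm (J (x - y) * U n y) \<le> J (x - y) * B" for n
    using U(2) J_nonneg by (intro AE_I2) (auto simp: abs_mult intro: mult_left_mono)
qed

subsection \<open>Harnack inequality, uniqueness and simplicity\<close>

lemma convol_ge_interval:
  assumes u: "u \<in> C_per R" "R > 0" "\<And>x. 0 \<le> u x"
    and J: "\<And>y. y \<in> {p..q} \<Longrightarrow> k \<le> J (x - y)"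
  shows "k * integral {p..q} u \<le> convol J u x"
proof -
  have si: "set_integrable lborel {p..q} u"
    using u(1) by (intro borel_integrable_atLeastAtMost') (auto dest: C_per_continuous intro: continuous_on_subset)
  have "k * integral {p..q} u = (\<integral>y. k * (indicator {p..q} y * u y) \<partial>lborel)"
    using set_borel_integral_eq_integral(2)[OF si] by (simp add: set_lebesgue_integral_def)
  also have "\<dots> \<le> convol J u x"
    unfolding convol_def
  proof (rule integral_mono)
    show "integrable lborel (\<lambda>y. k * (indicator {p..q} y * u y))"
      using si by (simp add: set_integrable_def)
    show "integrable lborel (\<lambda>y. J (x - y) * u y)" using C_per_convol_integrable[OF u(1,2)] .
    fix y show "k * (indicator {p..q} y * u y) \<le> J (x - y) * u y"
      using J[of y] J_nonneg[of "x - y"] u(3)[of y] by (auto simp: indicator_def intro: mult_right_mono)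
  qed
  finally show ?thesis .
qed

text \<open>The radius \<open>3 * h\<close> leaves room for three errors of size \<open>h\<close> in
  the Harnack argument: the position in the source interval, the offset of the centres, and the
  position in the target interval.\<close>

lemma kernel_lower_bound:
  assumes "J c > 0"
  obtains h k where "h > 0" "k > 0" "\<And>z. \<bar>z - c\<bar> \<le> 3 * h \<Longrightarrow> k \<le> J z"
proof -
  have "continuous (at c) J" using cont_J by (simp add: continuous_on_eq_continuous_at)
  then obtain d where d: "d > 0" "\<And>z. dist z c < d \<Longrightarrow> dist (J z) (J c) < J c / 2"
    unfolding continuous_at_eps_delta using assms half_gt_zero by blast
  show ?thesis
  proof (rule that[of "d / 6" "J c / 2"])
    fix z assume "\<bar>z - c\<bar> \<le> 3 * (d / 6)"
    hence "dist z c < d" using d(1) by (simp add: dist_real_def)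
    from d(2)[OF this] show "J c / 2 \<le> J z" by (simp add: dist_real_def abs_if split: if_splits)
  qed (use d assms in auto)
qed

text \<open>Mass of \<open>u\<close> near \<open>y\<close> forces \<open>u\<close> to be large near
  \<open>y + c\<close>, since \<open>J\<close> is positive near \<open>c\<close>. After
  \<open>n\<close> such jumps the centres reached fill a ball of radius \<open>n * h\<close> around
  \<open>y + n * c\<close>; once this is at least a period, periodicity brings every point into
  reach.\<close>

lemma harnack:
  assumes c: "J c > 0" and R: "R > 0" and C: "C > 0"
  obtains h e where "h > 0" "e > 0"
    "\<And>u x y. u \<in> C_per R \<Longrightarrow> (\<And>x. 0 \<le> u x) \<Longrightarrow> (\<And>x. convol J u x \<le> C * u x)
      \<Longrightarrow> e * integral {y - h..y + h} u \<le> u x"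
proof -
  obtain h k where h: "h > 0" and k: "k > 0" and Jk: "\<And>z. \<bar>z - c\<bar> \<le> 3 * h \<Longrightarrow> k \<le> J z"
    using kernel_lower_bound[OF c] by blast
  \<comment> \<open>The loss per jump: the pointwise bound \<open>k / C * I y\<close> integrated
    over an interval of length \<open>2 * h\<close>.\<close>
  define \<kappa> where "\<kappa> = 2 * h * k / C"
  have \<kappa>: "\<kappa> > 0" using h k C by (simp add: \<kappa>_def)
  obtain n :: nat where n: "2 * R \<le> of_nat n * h"
    using real_arch_simple[of "2 * R / h"] h by (auto simp: divide_le_eq)
  show ?thesis
  proof (rule that[OF h, of "k / C * \<kappa> ^ n"])
    show "k / C * \<kappa> ^ n > 0" using k C \<kappa> by simp
    fix u x y
    assume u: "u \<in> C_per R" "\<And>x. 0 \<le> u x" and Cu: "\<And>x. convol J u x \<le> C * u x"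
    define I where "I = (\<lambda>y. integral {y - h..y + h} u)"
    have int: "u integrable_on {p..q}" for p q
      using u(1) by (intro integrable_continuous_real) (auto dest: C_per_continuous intro: continuous_on_subset)
    have step0: "k / C * I y \<le> u x" if "\<bar>x - y - c\<bar> \<le> 2 * h" for x y
    proof -
      have "k * I y \<le> convol J u x"
        unfolding I_def
      proof (rule convol_ge_interval[OF u(1) R u(2)])
        fix z assume "z \<in> {y - h..y + h}"
        hence "\<bar>x - z - c\<bar> \<le> 3 * h" using that by auto
        thus "k \<le> J (x - z)" by (rule Jk)
      qed
      also note Cu[of x]
      finally show ?thesis using C by (simp add: field_simps)
    qed
    have step: "\<kappa> * I y \<le> I y'" if "\<bar>y' - y - c\<bar> \<le> h" for y y'
    proof -
      have "\<kappa> * I y = integral {y' - h..y' + h} (\<lambda>_. k / C * I y)"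
        using h by (simp add: \<kappa>_def)
      also have "\<dots> \<le> integral {y' - h..y' + h} u"
      proof (rule integral_le)
        fix x assume "x \<in> {y' - h..y' + h}"
        hence "\<bar>x - y - c\<bar> \<le> 2 * h" using that by auto
        thus "k / C * I y \<le> u x" by (rule step0)
      qed (auto simp: int)
      also have "\<dots> = I y'" by (simp add: I_def)
      finally show ?thesis .
    qed
    have iter: "\<kappa> ^ m * I y \<le> I y'" if "\<bar>y' - y - of_nat m * c\<bar> \<le> of_nat m * h" for y y' m
      using that
    proof (induction m arbitrary: y')
      case (Suc m)
      \<comment> \<open>The total offset is shared equally among the \<open>Suc m\<close> jumps, so
        that each share \<open>t\<close> is at most \<open>h\<close> in absolute value.\<close>
      define t where "t = (y' - y - of_nat (Suc m) * c) / of_nat (Suc m)"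
      have t: "\<bar>t\<bar> \<le> h" "of_nat (Suc m) * t = y' - y - of_nat (Suc m) * c"
        using Suc.prems by (auto simp: t_def abs_divide pos_divide_le_eq mult.commute)
      define y1 where "y1 = y' - c - t"
      have e: "y1 - y - of_nat m * c = of_nat m * t"
        using t(2) by (simp add: y1_def algebra_simps)
      have "\<bar>y1 - y - of_nat m * c\<bar> \<le> of_nat m * h"
        unfolding e abs_mult using t(1) by (simp add: mult_left_mono)
      from Suc.IH[OF this] have "\<kappa> ^ Suc m * I y \<le> \<kappa> * I y1" using \<kappa> by simp
      also have "\<dots> \<le> I y'" by (rule step) (use t(1) in \<open>simp add: y1_def\<close>)
      finally show ?case .
    qed simp
    \<comment> \<open>The additional \<open>c\<close> accounts for the last jump, which goes from an
      interval to a point by \<open>step0\<close>.\<close>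
    obtain j :: int where j: "\<bar>x + of_int j * (2 * R) - (y + of_nat n * c + c)\<bar> \<le> 2 * R"
      using period_translate[OF R] by blast
    define x' where "x' = x + of_int j * (2 * R)"
    have "\<bar>(x' - c) - y - of_nat n * c\<bar> = \<bar>x + of_int j * (2 * R) - (y + of_nat n * c + c)\<bar>"
      by (simp add: x'_def algebra_simps)
    hence "\<kappa> ^ n * I y \<le> I (x' - c)" using j n by (intro iter) linarith
    hence "k / C * (\<kappa> ^ n * I y) \<le> k / C * I (x' - c)" using k C by (intro mult_left_mono) auto
    also have "\<dots> \<le> u x'" using h by (intro step0) auto
    also have "u x' = u x" unfolding x'_def by (rule C_per_plus_of_int[OF u(1)])
    finally show "k / C * \<kappa> ^ n * integral {y - h..y + h} u \<le> u x" by (simp add: I_def mult.assoc)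
  qed
qed

lemma integral_ball_pos:
  assumes "u \<in> C_per R" "\<And>x. 0 \<le> u x" "u z > 0" "h > 0"
  shows "integral {z - h..z + h} u > 0"
proof -
  have c: "continuous_on {z - h..z + h} u"
    using assms(1) by (auto dest: C_per_continuous intro: continuous_on_subset)
  have "integral {z - h..z + h} u \<noteq> 0"
    using integral_eq_0_iff[OF c] assms by force
  moreover have "integral {z - h..z + h} u \<ge> 0"
    using assms by (intro integral_nonneg integrable_continuous_real c) auto
  ultimately show ?thesis by linarith
qed

text \<open>As \<open>b\<close> is bounded, the equation makes \<open>u\<close> a supersolution with
  the constant \<open>B + 1\<close>, and the Harnack inequality spreads the positivity at
  \<open>z\<close> everywhere.\<close>

lemma strong_maximum_principle:
  assumes c: "J c > 0" and R: "R > 0" and u: "u \<in> C_per R" "\<And>x. 0 \<le> u x"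
    and b: "b \<in> C_per R" and eq: "\<And>x. convol J u x = b x * u x" and z: "u z > 0"
  shows "u x > 0"
proof -
  obtain B where B: "\<And>x. \<bar>b x\<bar> \<le> B" using C_per_bounded[OF b R] by blast
  have B1: "B + 1 > 0" using B[of 0] by linarith
  have "convol J u x \<le> (B + 1) * u x" for x
    unfolding eq using B[of x] u(2)[of x] by (intro mult_right_mono) auto
  with harnack[OF c R B1] u obtain h e where h: "h > 0" "e > 0"
    "e * integral {z - h..z + h} u \<le> u x" by metis
  thus ?thesis using integral_ball_pos[OF u z h(1)] by (smt (verit) mult_pos_pos)
qed

section \<open>Comparison of eigenfunctions: uniqueness and simplicity\<close>

lemma touching:
  assumes "\<phi> \<in> C_per R" "\<psi> \<in> C_per R" "R > 0" "\<And>x. \<phi> x > 0"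
  obtains t x where "(\<lambda>x. t * \<phi> x - \<psi> x) \<in> C_per R" "\<And>y. 0 \<le> t * \<phi> y - \<psi> y" "t * \<phi> x = \<psi> x"
proof -
  have nz: "\<phi> x \<noteq> 0" for x using assms(4)[of x] by simp
  obtain x where x: "\<And>y. \<psi> y / \<phi> y \<le> \<psi> x / \<phi> x"
    using C_per_attains_sup[OF C_per_divide[OF assms(2,1) nz] assms(3)] by blast
  show ?thesis
  \<comment> \<open>The maximum of the quotient is the smallest factor that lifts
    \<open>\<phi>\<close> above \<open>\<psi>\<close>, with contact where it is attained. As
    \<open>\<psi>\<close> may have any sign, so may the factor.\<close>
  proof (rule that[of "\<psi> x / \<phi> x" x])
    show "(\<lambda>y. \<psi> x / \<phi> x * \<phi> y - \<psi> y) \<in> C_per R"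
      using assms by (intro C_per_arith C_per_const)
    show "0 \<le> \<psi> x / \<phi> x * \<phi> y - \<psi> y" for y using x[of y] assms(4)[of y] by (simp add: pos_divide_le_eq)
    show "\<psi> x / \<phi> x * \<phi> x = \<psi> x" using nz by simp
  qed
qed

lemma eigen_solutions_iff:
  "\<phi> \<in> eigen_solutions R J a l \<longleftrightarrow> \<phi> \<in> C_per R \<and> (\<forall>x. convol J \<phi> x = (1 - l - a x) * \<phi> x)"
  by (auto simp: eigen_solutions_def M_op_def algebra_simps)

text \<open>At a touching point the convolution of the nonnegative difference is nonnegative, while
  the two equations evaluate it to \<open>(m - l) * \<psi> x\<close>. Exchanging the eigenvalues
  gives uniqueness.\<close>

lemma principal_eigenvalue_le:
  assumes R: "R > 0" and "principal_eigenvalue R J a l" "principal_eigenvalue R J a m"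
  shows "l \<le> m"
proof (rule ccontr)
  assume "\<not> l \<le> m"
  obtain \<phi> \<psi> where \<phi>: "\<phi> \<in> C_per R" "\<And>x. convol J \<phi> x = (1 - l - a x) * \<phi> x" "\<And>x. \<phi> x > 0"
    and \<psi>: "\<psi> \<in> C_per R" "\<And>x. convol J \<psi> x = (1 - m - a x) * \<psi> x" "\<And>x. \<psi> x > 0"
    using assms unfolding principal_eigenvalue_def Bex_def eigen_solutions_iff by blast
  obtain t x where t: "(\<lambda>x. t * \<phi> x - \<psi> x) \<in> C_per R" "\<And>y. 0 \<le> t * \<phi> y - \<psi> y" "t * \<phi> x = \<psi> x"
    using touching[OF \<phi>(1) \<psi>(1) R \<phi>(3)] by metis
  have "0 \<le> convol J (\<lambda>x. t * \<phi> x - \<psi> x) x"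
    using convol_ge[OF C_per_convol_integrable[OF t(1) R] t(2)] .
  also have "\<dots> = (1 - l - a x) * (t * \<phi> x) - (1 - m - a x) * \<psi> x"
    using convol_lincomb[OF \<phi>(1) \<psi>(1) R] \<phi>(2) \<psi>(2) by simp
  also have "\<dots> = (m - l) * \<psi> x" unfolding t(3) by (simp add: algebra_simps)
  also have "\<dots> < 0" using \<open>\<not> l \<le> m\<close> \<psi>(3) by (simp add: mult_neg_pos)
  finally show False by simp
qed

lemma principal_eigenvalue_simple:
  assumes c: "J c > 0" and R: "R > 0" and a: "a \<in> C_per R" and pe: "principal_eigenvalue R J a l"
  shows "simple_eigenvalue R J a l"
proof -
  let ?E = "eigen_solutions R J a l"
  obtain \<phi> where \<phi>: "\<phi> \<in> C_per R" "\<And>x. convol J \<phi> x = (1 - l - a x) * \<phi> x" "\<And>x. \<phi> x > 0"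
    using pe unfolding principal_eigenvalue_def Bex_def eigen_solutions_iff by blast
  have multiple: "\<exists>t. \<psi> = fun_scale t \<phi>" if "\<psi> \<in> ?E" for \<psi>
  proof -
    have \<psi>: "\<psi> \<in> C_per R" "\<And>x. convol J \<psi> x = (1 - l - a x) * \<psi> x"
      using that unfolding eigen_solutions_iff by blast+
    obtain t z where t: "(\<lambda>x. t * \<phi> x - \<psi> x) \<in> C_per R" "\<And>y. 0 \<le> t * \<phi> y - \<psi> y" "t * \<phi> z = \<psi> z"
      using touching[OF \<phi>(1) \<psi>(1) R \<phi>(3)] by metis
    have b: "(\<lambda>x. 1 - l - a x) \<in> C_per R" using a by (intro C_per_arith C_per_const)
    have eq: "convol J (\<lambda>x. t * \<phi> x - \<psi> x) x = (1 - l - a x) * (t * \<phi> x - \<psi> x)" for x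
      unfolding convol_lincomb[OF \<phi>(1) \<psi>(1) R] \<phi>(2) \<psi>(2) by (simp add: algebra_simps)
    \<comment> \<open>The difference solves the same linear equation, so positivity at one point
      would exclude the contact at \<open>z\<close>.\<close>
    have "\<not> t * \<phi> y - \<psi> y > 0" for y
      using strong_maximum_principle[OF c R t(1,2) b eq, of y z] t(3) by auto
    hence "t * \<phi> y - \<psi> y = 0" for y using t(2)[of y] by (simp add: less_le)
    hence "\<psi> = fun_scale t \<phi>" by (simp add: fun_scale_def fun_eq_iff)
    thus ?thesis ..
  qed
  have in_E: "fun_scale t \<phi> \<in> ?E" for t
    using \<phi>(1) unfolding eigen_solutions_iff fun_scale_def convol_cmult \<phi>(2)
    by (auto intro: C_per_arith C_per_const)
  have span: "?E = fun_vs.span {\<phi>}"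
    using multiple in_E unfolding fun_vs.span_singleton by auto
  have "\<phi> \<noteq> 0" using \<phi>(3)[of 0] by auto
  hence "\<not> fun_vs.dependent {\<phi>}" by simp
  hence "fun_vs.dim ?E = 1" unfolding span using fun_vs.dim_span_eq_card_independent[of "{\<phi>}"] by simp
  moreover have "fun_vs.subspace ?E" unfolding span by (rule fun_vs.subspace_span)
  ultimately show ?thesis by (simp add: simple_eigenvalue_def)
qed

subsection \<open>Existence\<close>

text \<open>The gap \<open>s\<close> is the same for all supersolutions; it keeps
  \<open>\<mu> - a x\<close> away from 0 in the later passage to the limit.\<close>

lemma supersolution_gap:
  assumes c: "J c > 0" and R: "R > 0" and a: "a \<in> C_per R" and L: "L-lipschitz_on UNIV a"
    and p: "\<And>y. a y \<le> a p"
  obtains s where "s > 0"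
    "\<And>\<mu> v. a p < \<mu> \<Longrightarrow> v \<in> C_per R \<Longrightarrow> (\<And>x. v x > 0)
      \<Longrightarrow> (\<And>x. convol J v x \<le> (\<mu> - a x) * v x) \<Longrightarrow> a p + s \<le> \<mu>"
proof -
  obtain q where q: "\<And>y. a q \<le> a y" using C_per_attains_inf[OF a R] by blast
  \<comment> \<open>An upper bound for \<open>\<mu> - a x\<close> as long as \<open>\<mu>\<close>
    exceeds \<open>a p\<close> by at most 1.\<close>
  define C where "C = a p - a q + 1"
  have C: "C > 0" using p[of q] by (simp add: C_def)
  obtain h e where h: "h > 0" and e: "e > 0" and harn: "\<And>u x y. u \<in> C_per R \<Longrightarrow> (\<And>x. 0 \<le> u x)
      \<Longrightarrow> (\<And>x. convol J u x \<le> C * u x) \<Longrightarrow> e * integral {y - h..y + h} u \<le> u x"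
    using harnack[OF c R C] by metis
  define K where "K = L + 1"
  have K: "K > 0" "L \<le> K" using lipschitz_on_nonneg[OF L] by (auto simp: K_def)
  \<comment> \<open>Chosen so that \<open>0 < d < s\<close> gives
    \<open>d * exp (K / e) < d + K * h\<close>, that is,
    \<open>K < e * ln ((d + K * h) / d)\<close>.\<close>
  define s where "s = min 1 (K * h / exp (K / e))"
  have s: "s > 0" "s \<le> 1" "s * exp (K / e) \<le> K * h"
    using K h by (auto simp: s_def min_mult_distrib_right min_le_iff_disj)
  show ?thesis
  proof (rule that[OF s(1)], rule ccontr)
    fix \<mu> v
    assume \<mu>: "a p < \<mu>" and v: "v \<in> C_per R" "\<And>x. v x > 0"
      and sup: "\<And>x. convol J v x \<le> (\<mu> - a x) * v x" and "\<not> a p + s \<le> \<mu>"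
    define d where "d = \<mu> - a p"
    have d: "0 < d" "d < s" using \<mu> \<open>\<not> a p + s \<le> \<mu>\<close> by (auto simp: d_def)
    define I where "I = integral {p - h..p + h} v"
    have v0: "0 \<le> v x" for x using v(2)[of x] by simp
    have I: "I > 0" unfolding I_def by (rule integral_ball_pos[OF v(1) v0 v(2) h])
    have "convol J v x \<le> C * v x" for x
    proof -
      have "\<mu> - a x \<le> C" using q[of x] d s(2) by (simp add: C_def d_def)
      thus ?thesis using sup[of x] v0[of x] by (meson mult_right_mono order_trans)
    qed
    hence lower: "e * I \<le> v x" for x unfolding I_def using harn[OF v(1) v0] by blast
    \<comment> \<open>Since \<open>J\<close> has mass 1, the constant lower bound on
      \<open>v\<close> passes to its convolution. Fed back into the supersolution inequality, it
      forces \<open>v\<close> to be large where \<open>\<mu> - a x\<close> is small.\<close>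
    have sup': "e * I \<le> (\<mu> - a x) * v x" for x
      using convol_ge[OF C_per_convol_integrable[OF v(1) R] lower] sup[of x] by (rule order_trans)
    have ptw: "e * I / (d + K * (x - p)) \<le> v x" if "x \<in> {p..p + h}" for x
    proof -
      have "dist (a p) (a x) \<le> L * dist p x" using lipschitz_onD[OF L] by simp
      hence "a p - a x \<le> L * (x - p)" using that by (auto simp: dist_real_def)
      also have "\<dots> \<le> K * (x - p)" using K that by (intro mult_right_mono) auto
      finally have "\<mu> - a x \<le> d + K * (x - p)" by (simp add: d_def)
      hence "e * I \<le> (d + K * (x - p)) * v x"
        using sup'[of x] v0[of x] by (meson mult_right_mono order_trans)
      moreover have "d + K * (x - p) > 0" using d K that by (intro add_pos_nonneg) auto
      ultimately show ?thesis by (simp add: pos_divide_le_eq mult.commute)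
    qed
    have "((\<lambda>x. e * I / (d + K * (x - p))) has_integral
        e * I / K * ln (d + K * (p + h - p)) - e * I / K * ln (d + K * (p - p))) {p..p + h}"
    proof (rule fundamental_theorem_of_calculus)
      fix x assume x: "x \<in> {p..p + h}"
      have "d + K * (x - p) > 0" using d K x by (intro add_pos_nonneg) auto
      thus "((\<lambda>x. e * I / K * ln (d + K * (x - p))) has_vector_derivative
          e * I / (d + K * (x - p))) (at x within {p..p + h})"
        unfolding has_real_derivative_iff_has_vector_derivative[symmetric]
        using K by (auto intro!: derivative_eq_intros simp: divide_simps)
    qed (use h in simp)
    moreover have "d + K * h > 0" using d K h by (simp add: add_pos_pos)
    hence "e * I / K * ln (d + K * (p + h - p)) - e * I / K * ln (d + K * (p - p))
        = e * I / K * ln ((d + K * h) / d)"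
      using d(1) by (simp add: ln_div right_diff_distrib)
    ultimately have int: "((\<lambda>x. e * I / (d + K * (x - p))) has_integral
        e * I / K * ln ((d + K * h) / d)) {p..p + h}"
      by (simp only:)
    have vint: "v integrable_on {x..y}" for x y
      using v(1) by (intro integrable_continuous_real) (auto dest: C_per_continuous intro: continuous_on_subset)
    have "e * I / K * ln ((d + K * h) / d) \<le> integral {p..p + h} v"
      using has_integral_le[OF int integrable_integral[OF vint]] ptw by simp
    also have "\<dots> \<le> I"
      unfolding I_def using h v0 by (intro integral_subset_le vint) auto
    \<comment> \<open>The estimate is homogeneous in \<open>v\<close>, so the positive factor
      \<open>I\<close> cancels.\<close>
    finally have "e * ln ((d + K * h) / d) \<le> K"
      using I K by (simp add: pos_divide_le_eq)
    moreover have "K < e * ln ((d + K * h) / d)"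
    proof -
      have "d * exp (K / e) < K * h + d"
        using mult_strict_right_mono[OF d(2) exp_gt_zero[of "K / e"]] s(3) d(1) by linarith
      hence "exp (K / e) < (d + K * h) / d" using d(1) by (simp add: pos_less_divide_eq mult.commute add.commute)
      moreover have "(d + K * h) / d > 0" using d K h by (simp add: add_pos_pos)
      ultimately have "K / e < ln ((d + K * h) / d)" by (metis exp_less_cancel_iff exp_ln)
      thus ?thesis using e by (simp add: pos_divide_less_eq mult.commute)
    qed
    ultimately show False by simp
  qed
qed

text \<open>The iterates of \<open>T\<close> from 0 increase and stay below a multiple of the strict
  supersolution, so they converge to a fixed point.\<close>

lemma monotone_iteration:
  assumes R: "R > 0" and a: "a \<in> C_per R" and \<mu>: "\<And>x. a x < \<mu>"
    and v: "v \<in> C_per R" "\<And>x. v x > 0" and sup: "\<And>x. convol J v x < (\<mu> - a x) * v x"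
  obtains u where "u \<in> C_per R" "\<And>x. u x > 0" "\<And>x. (\<mu> - a x) * u x = 1 + convol J u x"
proof -
  have b: "(\<lambda>x. \<mu> - a x) \<in> C_per R" using a by (intro C_per_arith C_per_const)
  have bpos: "\<mu> - a x > 0" for x using \<mu>[of x] by simp
  have bnz: "\<mu> - a x \<noteq> 0" for x using \<mu>[of x] by simp
  have "(\<lambda>x. (\<mu> - a x) * v x - convol J v x) \<in> C_per R"
    using C_per_arith(2)[OF C_per_arith(3)[OF b v(1)] C_per_convol[OF v(1) R]] .
  then obtain z where z: "\<And>x. (\<mu> - a z) * v z - convol J v z \<le> (\<mu> - a x) * v x - convol J v x"
    using C_per_attains_inf[OF _ R] by blast
  \<comment> \<open>The least defect of \<open>v\<close>; division by it raises the defect to at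
    least 1, which absorbs the source term.\<close>
  define \<eta> where "\<eta> = (\<mu> - a z) * v z - convol J v z"
  have \<eta>: "\<eta> > 0" using sup[of z] by (simp add: \<eta>_def)
  define V where "V = (\<lambda>x. 1 / \<eta> * v x)"
  have V: "V \<in> C_per R" unfolding V_def using v(1) by (intro C_per_arith C_per_const)
  have Vsup: "1 + convol J V x \<le> (\<mu> - a x) * V x" for x
  proof -
    have "(\<eta> + convol J v x) / \<eta> \<le> ((\<mu> - a x) * v x) / \<eta>"
      using z[of x] \<eta> by (intro divide_right_mono) (auto simp: \<eta>_def)
    thus ?thesis using \<eta> unfolding V_def convol_cmult by (simp add: add_divide_distrib)
  qed
  define T where "T = (\<lambda>u x. (1 + convol J u x) / (\<mu> - a x))"
  define U where "U = (\<lambda>n. (T ^^ n) (\<lambda>_. 0))"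
  have U_Suc: "U (Suc n) = T (U n)" for n by (simp add: U_def)
  have T: "T u \<in> C_per R" if "u \<in> C_per R" for u
    unfolding T_def using that R b bnz by (intro C_per_divide C_per_arith(1) C_per_const C_per_convol)
  have U: "U n \<in> C_per R" for n
    by (induction n) (simp add: U_def C_per_const, simp add: U_Suc T)
  have T_mono: "T u x \<le> T w x" if "u \<in> C_per R" "w \<in> C_per R" "\<And>x. u x \<le> w x" for u w x
    unfolding T_def using convol_mono[OF C_per_convol_integrable[OF that(1) R] C_per_convol_integrable[OF that(2) R] that(3)]
      bpos[of x] by (intro divide_right_mono add_mono) auto
  have U0: "U 0 x = 0" for x by (simp add: U_def)
  have TV: "T V x \<le> V x" for x
    unfolding T_def using Vsup[of x] bpos[of x] by (simp add: pos_divide_le_eq mult.commute)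
  have le_V: "U n x \<le> V x" for n x
  proof (induction n arbitrary: x)
    case 0 show ?case using v(2)[of x] \<eta> by (simp add: U0 V_def)
  next
    case (Suc n)
    have "T (U n) x \<le> T V x" using Suc by (intro T_mono U V)
    thus ?case using TV[of x] by (simp add: U_Suc)
  qed
  have inc: "U n x \<le> U (Suc n) x" for n x
  proof (induction n arbitrary: x)
    case 0
    show ?case unfolding U_Suc T_def using bpos[of x] convol_const[of 0 x] by (simp add: U_def)
  next
    case (Suc n) 
    have "T (U n) x \<le> T (U (Suc n)) x" using Suc by (intro T_mono U)
    thus ?case by (simp only: U_Suc)
  qed
  have incseq: "incseq (\<lambda>n. U n x)" for x using inc by (rule incseq_SucI)
  have nonneg: "0 \<le> U n x" for n x using incseqD[OF incseq, of 0 n x] by (simp add: U0)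
  define u where "u = (\<lambda>x. lim (\<lambda>n. U n x))"
  have lim: "(\<lambda>n. U n x) \<longlonglongrightarrow> u x" for x
    using incseq_convergent[OF incseq, of x "V x"] le_V unfolding u_def
    by (metis convergent_LIMSEQ_iff convergentI)
  obtain B where B: "\<And>x. \<bar>V x\<bar> \<le> B" using C_per_bounded[OF V R] by blast
  have UB: "\<bar>U n x\<bar> \<le> B" for n x using nonneg[of n x] le_V[of n x] B[of x] by linarith
  have u_meas: "u \<in> borel_measurable borel"
    by (rule borel_measurable_LIMSEQ_real[OF lim]) (use U C_per_measurable in auto)
  have uB: "\<bar>u x\<bar> \<le> B" for x
    by (rule LIMSEQ_le_const2[OF tendsto_rabs[OF lim]]) (use UB in auto)
  have u_per: "u (x + 2 * R) = u x" for x
    unfolding u_def using C_perD[OF U] by simp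
  have "(\<lambda>n. U (Suc n) x) \<longlonglongrightarrow> T u x" for x
    unfolding U_Suc T_def using convol_tendsto[OF C_per_measurable[OF U] UB lim] bnz
    by (intro tendsto_intros)
  hence u_eq: "u x = T u x" for x using LIMSEQ_Suc[OF lim[of x]] LIMSEQ_unique by blast
  \<comment> \<open>A monotone limit need not be continuous; the fixed point equation supplies
    continuity, because \<open>T\<close> regularises.\<close>
  have "T u \<in> C_per R"
    unfolding T_def using convol_in_C_per[OF u_meas uB u_per] b bnz
    by (intro C_per_divide C_per_arith(1) C_per_const)
  hence uC: "u \<in> C_per R" using u_eq by (metis ext)
  have u0: "0 \<le> u x" for x by (rule LIMSEQ_le_const[OF lim]) (use nonneg in auto)
  have "0 \<le> convol J u x" for x by (rule convol_ge[OF C_per_convol_integrable[OF uC R] u0])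
  hence "u x > 0" for x unfolding u_eq[of x] T_def using bpos[of x] by (simp add: add_pos_nonneg)
  moreover have "(\<mu> - a x) * u x = 1 + convol J u x" for x
    using u_eq[of x] bnz[of x] by (simp add: T_def)
  ultimately show ?thesis using uC that by blast
qed

text \<open>Compactness acts on the convolutions, not directly on \<open>w n\<close>. Because
  \<open>m\<close> exceeds the maximum of \<open>a\<close>, the equation can be divided by
  \<open>\<mu> n - a x\<close>, which carries convergence over to \<open>w n\<close>.\<close>

lemma approximate_eigenfunctions_converge:
  assumes R: "R > 0" and a: "a \<in> C_per R" and p: "\<And>y. a y \<le> a p" and m: "a p < m"
    and \<mu>: "\<mu> \<longlonglongrightarrow> m" "\<And>n. m \<le> \<mu> n" and \<epsilon>: "\<epsilon> \<longlonglongrightarrow> 0"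
    and w: "\<And>n. w n \<in> C_per R" "\<And>n x. 0 \<le> w n x" "\<And>n x. w n x \<le> 1" "\<And>n. w n (z n) = 1"
    and eq: "\<And>n x. (\<mu> n - a x) * w n x = \<epsilon> n + convol J (w n) x"
  obtains \<phi> x where "\<phi> \<in> C_per R" "\<And>x. 0 \<le> \<phi> x" "\<phi> x > 0" "\<And>x. (m - a x) * \<phi> x = convol J \<phi> x"
proof -
  have w1: "\<bar>w n x\<bar> \<le> 1" for n x using w(2,3)[of n x] by simp
  have F1: "norm (convol J (w n) x) \<le> 1" for n x
    using convol_le[OF C_per_convol_integrable[OF w(1) R] w(3)]
      convol_ge[OF C_per_convol_integrable[OF w(1) R] w(2)] by simp
  obtain g k where k: "strict_mono (k :: nat \<Rightarrow> nat)" and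
    unif: "\<And>e. 0 < e \<Longrightarrow> \<exists>N. \<forall>n x. N \<le> n \<and> x \<in> {0..2 * R} \<longrightarrow> norm (convol J (w (k n)) x - g x) < e"
  proof (rule Arzela_Ascoli[of "{0..2 * R}" "\<lambda>n. convol J (w n)" 1])
    fix x e :: real assume "0 < e"
    then obtain d where d: "d > 0" "\<And>u z. u \<in> borel_measurable borel \<Longrightarrow> (\<And>y. \<bar>u y\<bar> \<le> 1) \<Longrightarrow> \<bar>z - x\<bar> < d
      \<Longrightarrow> \<bar>convol J u z - convol J u x\<bar> < e"
      using convol_equicontinuous[of e 1 x] by auto
    have "norm (convol J (w n) x - convol J (w n) y) < e" if "norm (x - y) < d" for n y
      using d(2)[OF C_per_measurable[OF w(1)[of n]] w1, of y] that by (simp add: abs_minus_commute)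
    thus "\<exists>d>0. \<forall>n y. y \<in> {0..2 * R} \<and> norm (x - y) < d
        \<longrightarrow> norm (convol J (w n) x - convol J (w n) y) < e"
      using d(1) by blast
  qed (use F1 in auto)
  have ptw: "(\<lambda>n. convol J (w (k n)) x) \<longlonglongrightarrow> g x" if "x \<in> {0..2 * R}" for x
    unfolding LIMSEQ_iff using unif that by meson
  define G where "G = (\<lambda>x. lim (\<lambda>n. convol J (w (k n)) x))"
  have G: "(\<lambda>n. convol J (w (k n)) x) \<longlonglongrightarrow> G x" for x
  proof -
    obtain y where y: "y \<in> {0..2 * R}" "\<And>u. u \<in> C_per R \<Longrightarrow> u x = u y"
      using C_per_reduce[OF R] by metis
    have "(\<lambda>n. convol J (w (k n)) x) \<longlonglongrightarrow> g y"
      using ptw[OF y(1)] y(2)[OF C_per_convol[OF w(1) R]] by simp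
    thus ?thesis unfolding G_def by (metis limI)
  qed
  define \<phi> where "\<phi> = (\<lambda>x. G x / (m - a x))"
  have mpos: "m - a x > 0" for x using p[of x] m by linarith
  have mnz: "m - a x \<noteq> 0" for x using mpos[of x] by simp
  have \<mu>pos: "\<mu> n - a x > 0" for n x using mpos[of x] \<mu>(2)[of n] by linarith
  have w_eq: "w n x = (\<epsilon> n + convol J (w n) x) / (\<mu> n - a x)" for n x
    using eq[of n x] \<mu>pos[of n x] by (simp add: nonzero_eq_divide_eq mult.commute)
  have lim: "(\<lambda>n. w (k n) x) \<longlonglongrightarrow> \<phi> x" for x
  proof -
    have "(\<lambda>n. (\<epsilon> (k n) + convol J (w (k n)) x) / (\<mu> (k n) - a x)) \<longlonglongrightarrow> (0 + G x) / (m - a x)"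
      using LIMSEQ_subseq_LIMSEQ[OF \<mu>(1) k] LIMSEQ_subseq_LIMSEQ[OF \<epsilon> k] mnz G
      by (intro tendsto_intros) (auto simp: o_def)
    thus ?thesis by (simp add: \<phi>_def flip: w_eq)
  qed
  have \<phi>_meas: "\<phi> \<in> borel_measurable borel"
    by (rule borel_measurable_LIMSEQ_real[OF lim]) (use C_per_measurable[OF w(1)] in auto)
  have \<phi>1: "\<bar>\<phi> x\<bar> \<le> 1" for x
    by (rule LIMSEQ_le_const2[OF tendsto_rabs[OF lim]]) (use w1 in auto)
  have \<phi>_per: "\<phi> (x + 2 * R) = \<phi> x" for x
    using lim[of x] lim[of "x + 2 * R"] C_perD[OF w(1)] by (auto intro: LIMSEQ_unique)
  have "convol J \<phi> x = G x" for x
    using convol_tendsto[OF C_per_measurable[OF w(1)] w1 lim] G LIMSEQ_unique by blast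
  hence \<phi>_eq: "convol J \<phi> = G" by blast
  have "G \<in> C_per R" using convol_in_C_per[OF \<phi>_meas \<phi>1 \<phi>_per] by (simp add: \<phi>_eq)
  hence \<phi>C: "\<phi> \<in> C_per R"
    unfolding \<phi>_def using a mnz by (intro C_per_divide C_per_arith C_per_const)
  have \<phi>0: "0 \<le> \<phi> x" for x by (rule LIMSEQ_le_const[OF lim]) (use w(2) in auto)
  \<comment> \<open>The limit is not zero: where \<open>w n\<close> equals 1, the equation bounds
    \<open>\<epsilon> n\<close> plus the convolution below by \<open>d\<close>. These points move
    with \<open>n\<close>, so uniform convergence on a period is used to reach
    \<open>g\<close>.\<close>
  have "\<exists>x. G x > 0"
  proof -
    define d where "d = m - a p"
    have d: "d > 0" using m by (simp add: d_def)
    have "\<forall>\<^sub>F n in sequentially. \<epsilon> (k n) < d / 2"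
      using order_tendstoD(2)[OF LIMSEQ_subseq_LIMSEQ[OF \<epsilon> k], of "d / 2"] d by (simp add: o_def)
    moreover obtain N where N: "\<And>n x. N \<le> n \<Longrightarrow> x \<in> {0..2 * R} \<Longrightarrow> norm (convol J (w (k n)) x - g x) < d / 2"
      using unif[of "d / 2"] d by auto
    ultimately obtain n where n: "n \<ge> N" "\<epsilon> (k n) < d / 2"
      by (metis (mono_tags, lifting) eventually_sequentially le_cases order_refl)
    obtain y where y: "y \<in> {0..2 * R}" "\<And>u. u \<in> C_per R \<Longrightarrow> u (z (k n)) = u y"
      using C_per_reduce[OF R] by metis
    have "d \<le> \<mu> (k n) - a y" using \<mu>(2)[of "k n"] p[of y] by (simp add: d_def)
    also have "\<dots> = \<epsilon> (k n) + convol J (w (k n)) y"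
      using eq[of "k n" y] y(2)[OF w(1)] w(4)[of "k n"] by simp
    finally have "d / 2 < convol J (w (k n)) y" using n(2) by simp
    hence "g y > 0" using N[OF n(1) y(1)] by (simp add: abs_if split: if_splits)
    moreover have "G y = g y" using G ptw[OF y(1)] LIMSEQ_unique by blast
    ultimately show ?thesis by metis
  qed
  then obtain x where "\<phi> x > 0" using mpos unfolding \<phi>_def by (meson divide_pos_pos)
  moreover have "(m - a x) * \<phi> x = convol J \<phi> x" for x
    unfolding \<phi>_eq using mnz[of x] by (simp add: \<phi>_def)
  ultimately show ?thesis using that \<phi>C \<phi>0 by blast
qed

lemma principal_eigenvalue_exists:
  assumes c: "J c > 0" and R: "R > 0" and a: "a \<in> C_per R" and L: "L-lipschitz_on UNIV a"
  shows "\<exists>l. principal_eigenvalue R J a l"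
proof -
  obtain p where p: "\<And>y. a y \<le> a p" using C_per_attains_sup[OF a R] by blast
  define S where "S = {\<mu>. a p < \<mu> \<and>
    (\<exists>v \<in> C_per R. (\<forall>x. v x > 0) \<and> (\<forall>x. convol J v x < (\<mu> - a x) * v x))}"
  obtain s where s: "s > 0" and gap: "\<And>\<mu> v. a p < \<mu> \<Longrightarrow> v \<in> C_per R \<Longrightarrow> (\<And>x. v x > 0)
      \<Longrightarrow> (\<And>x. convol J v x \<le> (\<mu> - a x) * v x) \<Longrightarrow> a p + s \<le> \<mu>"
    using supersolution_gap[OF c R a L p] by metis
  have S_ge: "a p + s \<le> \<mu>" if "\<mu> \<in> S" for \<mu>
    using that gap unfolding S_def by (blast intro: less_imp_le)
  have "1 < a p + 2 - a x" for x using p[of x] by linarith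
  \<comment> \<open>The constant 1 is its own convolution, hence a strict supersolution
    here.\<close>
  hence "a p + 2 \<in> S"
    unfolding S_def by (auto intro!: bexI[OF _ C_per_const[of 1]] simp: convol_const)
  hence ne: "S \<noteq> {}" by blast
  have bdd: "bdd_below S" using S_ge by (rule bdd_belowI)
  define m where "m = Inf S"
  have m: "a p < m" using cInf_greatest[OF ne S_ge] s by (simp add: m_def)
  define P where "P = (\<lambda>\<delta> \<mu> \<epsilon> w z. m \<le> \<mu> \<and> \<mu> < m + \<delta> \<and> 0 < \<epsilon> \<and> \<epsilon> \<le> \<delta> \<and> w \<in> C_per R \<and>
      (\<forall>x. 0 \<le> w x) \<and> (\<forall>x. w x \<le> 1) \<and> w z = 1 \<and> (\<forall>x. (\<mu> - a x) * w x = \<epsilon> + convol J w x))"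
  have approx: "\<exists>\<mu> \<epsilon> w z. P \<delta> \<mu> \<epsilon> w z" if \<delta>: "\<delta> > 0" for \<delta>
  proof -
    obtain \<mu> where \<mu>: "\<mu> \<in> S" "\<mu> < m + \<delta>"
      using cInf_lessD[OF ne, of "m + \<delta>"] \<delta> by (auto simp: m_def)
    have m\<mu>: "m \<le> \<mu>" unfolding m_def using \<mu>(1) bdd by (rule cInf_lower)
    have a\<mu>: "a x < \<mu>" for x using p[of x] m m\<mu> by linarith
    obtain v where v: "v \<in> C_per R" "\<And>x. v x > 0" "\<And>x. convol J v x < (\<mu> - a x) * v x"
      using \<mu>(1) unfolding S_def by blast
    obtain u where u: "u \<in> C_per R" "\<And>x. u x > 0" "\<And>x. (\<mu> - a x) * u x = 1 + convol J u x"
      using monotone_iteration[OF R a a\<mu> v] by blast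
    obtain z where z: "\<And>x. u x \<le> u z" using C_per_attains_sup[OF u(1) R] by blast
    define \<epsilon> where "\<epsilon> = 1 / u z"
    define w where "w = (\<lambda>x. \<epsilon> * u x)"
    have \<epsilon>: "\<epsilon> > 0" using u(2) by (simp add: \<epsilon>_def)
    have wC: "w \<in> C_per R" unfolding w_def by (rule C_per_arith(3)[OF C_per_const u(1)])
    have w: "\<And>x. 0 < w x" "\<And>x. w x \<le> 1" "w z = 1"
      unfolding w_def using \<epsilon> u(2) z
      by (auto simp: \<epsilon>_def less_imp_neq[symmetric])
    have w_eq: "(\<mu> - a x) * w x = \<epsilon> + convol J w x" for x
    proof -
      have "(\<mu> - a x) * w x = \<epsilon> * ((\<mu> - a x) * u x)" by (simp add: w_def)
      also have "\<dots> = \<epsilon> + convol J w x" unfolding u(3) w_def convol_cmult by (simp add: distrib_left)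
      finally show ?thesis .
    qed
    \<comment> \<open>This is the blow-up of \<open>u\<close>. Otherwise some
      \<open>\<nu> < m\<close> has \<open>\<mu> - \<nu> < \<epsilon>\<close>; lowering
      \<open>\<mu>\<close> to \<open>\<nu>\<close> costs at most \<open>\<mu> - \<nu>\<close>, as
      \<open>w\<close> is at most 1, so \<open>w\<close> would be a strict supersolution below the
      infimum.\<close>
    have "\<epsilon> \<le> \<delta>"
    proof (rule ccontr)
      assume "\<not> \<epsilon> \<le> \<delta>"
      then obtain \<nu> where \<nu>: "max (a p) (\<mu> - \<epsilon>) < \<nu>" "\<nu> < m"
        using dense[of "max (a p) (\<mu> - \<epsilon>)" m] m \<mu>(2) by auto
      have "convol J w x < (\<nu> - a x) * w x" for x
      proof -
        have "(\<mu> - \<nu>) * w x \<le> (\<mu> - \<nu>) * 1" using w(2) \<nu>(2) m\<mu> by (intro mult_left_mono) auto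
        hence "(\<mu> - \<nu>) * w x < \<epsilon>" using \<nu>(1) by simp
        thus ?thesis using w_eq[of x] by (simp add: algebra_simps)
      qed
      hence "\<nu> \<in> S" using wC w(1) \<nu>(1) unfolding S_def by auto
      hence "m \<le> \<nu>" unfolding m_def using bdd by (rule cInf_lower)
      thus False using \<nu>(2) by simp
    qed
    hence "P \<delta> \<mu> \<epsilon> w z"
      unfolding P_def using m\<mu> \<mu>(2) \<epsilon> wC w w_eq by (simp add: less_imp_le)
    thus ?thesis by blast
  qed
  have "\<forall>n. \<exists>\<mu> \<epsilon> w z. P (inverse (real (Suc n))) \<mu> \<epsilon> w z"
    by (intro allI approx) simp
  then obtain \<mu> \<epsilon> w z where "\<And>n. P (inverse (real (Suc n))) (\<mu> n) (\<epsilon> n) (w n) (z n)"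
    by metis
  hence seq: "\<And>n. m \<le> \<mu> n" "\<And>n. \<mu> n < m + inverse (real (Suc n))" "\<And>n. 0 < \<epsilon> n"
    "\<And>n. \<epsilon> n \<le> inverse (real (Suc n))" "\<And>n. w n \<in> C_per R" "\<And>n x. 0 \<le> w n x" "\<And>n x. w n x \<le> 1"
    "\<And>n. w n (z n) = 1" "\<And>n x. (\<mu> n - a x) * w n x = \<epsilon> n + convol J (w n) x"
    unfolding P_def by blast+
  have "(\<lambda>n. m + inverse (real (Suc n))) \<longlonglongrightarrow> m + 0"
    by (intro tendsto_add tendsto_const LIMSEQ_inverse_real_of_nat)
  hence "(\<lambda>n. m + inverse (real (Suc n))) \<longlonglongrightarrow> m" by simp
  hence \<mu>_lim: "\<mu> \<longlonglongrightarrow> m"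
    by (rule tendsto_sandwich[OF always_eventually always_eventually tendsto_const[of m], rotated 2])
      (use seq(1,2) less_imp_le in blast)+
  have \<epsilon>_lim: "\<epsilon> \<longlonglongrightarrow> 0"
    by (rule tendsto_sandwich[OF always_eventually always_eventually tendsto_const[of 0]
          LIMSEQ_inverse_real_of_nat])
      (use seq(3,4) less_imp_le in blast)+
  obtain \<phi> y where \<phi>: "\<phi> \<in> C_per R" "\<And>x. 0 \<le> \<phi> x" "\<phi> y > 0" "\<And>x. (m - a x) * \<phi> x = convol J \<phi> x"
    using approximate_eigenfunctions_converge[OF R a p m \<mu>_lim seq(1) \<epsilon>_lim seq(5-9)] by blast
  have "(\<lambda>x. m - a x) \<in> C_per R" using a by (intro C_per_arith C_per_const)
  hence "\<phi> x > 0" for x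
    using strong_maximum_principle[OF c R \<phi>(1,2) _ _ \<phi>(3)] \<phi>(4) by metis
  \<comment> \<open>The shift by 1 undoes the term \<open>- u\<close> of
    \<open>M_op\<close>.\<close>
  moreover have "\<phi> \<in> eigen_solutions R J a (1 - m)"
    using \<phi>(1,4) by (simp add: eigen_solutions_iff)
  ultimately show ?thesis unfolding principal_eigenvalue_def by blast
qed

end

theorem theorem1p2:
  fixes R :: real and J a :: "real \<Rightarrow> real"
  assumes "R > 0"
    and "continuous_on UNIV J"
    and "\<forall>x. J x \<ge> 0"
    and "integrable lborel J"
    and "(\<integral>x. J x \<partial>lborel) = 1"
    and "\<exists>\<alpha> \<beta>. \<alpha> < 0 \<and> 0 < \<beta> \<and> J \<alpha> > 0 \<and> J \<beta> > 0"
    and "\<exists>L. L-lipschitz_on UNIV a"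
    and "periodic_fun_simple a (2 * R)"
  shows "(\<exists>!l. principal_eigenvalue R J a l) \<and>
    (\<forall>l. principal_eigenvalue R J a l \<longrightarrow> simple_eigenvalue R J a l)"
proof -
  interpret dispersal_kernel J using assms(2-5) by unfold_locales auto
  obtain c where c: "J c > 0" using assms(6) by blast
  obtain L where L: "L-lipschitz_on UNIV a" using assms(7) by blast
  have a: "a \<in> C_per R"
    using lipschitz_on_continuous_on[OF L] assms(8) by (simp add: C_per_def)
  show ?thesis
    using principal_eigenvalue_exists[OF c assms(1) a L] principal_eigenvalue_le[OF assms(1)]
      principal_eigenvalue_simple[OF c assms(1) a] by (metis order_antisym)
qed

end
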